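(* Let $\mathcal{T}=(t_{i_1\ldots i_k})$ be a zero diagonal nonzero symmetric tensor of order $k$ and dimension $n$, where $n,k\ge 2$. Suppose that $k$ is even or $\mathcal{T}$ is nonnegative. Let $\mathbf{x}$ be a unit eigenvector corresponding to $\lambda_{\max}(\mathcal{T})$. Let $\emptyset\ne I\subset [n]$. Then $$\lambda_{\max}(\mathcal{T})\Bigl(1-k\sum_{i\in [n]\setminus I}x_i^k\Bigr)-\sum_{j=1}^{k-1}(-1)^j\binom{k}{j+1}\sum_{\substack{i_1,\ldots,i_{j+1}\in [n]\setminus I\\ i_{j+2},\ldots,i_k\in[n]}}t_{i_1 \ldots i_k}x_{i_1}\cdots x_{i_k}\ \le\ \lambda_{\max}(\mathcal{T}[I])\ \le\ \lambda_{\max}(\mathcal{T}).$$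
   Context: $[n]=\{1,\dots,n\}$. A (real) tensor $\mathcal{T}=(t_{i_1\ldots i_k})$ of order $k$ and dimension $n$ is an array of real numbers indexed by $(i_1,\dots,i_k)\in[n]^k$. It is symmetric if its entries are invariant under all permutations of the indices, zero diagonal if $t_{i\ldots i}=0$ for all $i\in[n]$, and nonnegative if all entries are nonnegative. For a vector $\mathbf{x}=(x_1,\dots,x_n)^\top$, $(\mathcal{T}\mathbf{x}^{k-1})_i=\sum_{i_2,\dots,i_k\in[n]}t_{ii_2\dots i_k}x_{i_2}\cdots x_{i_k}$. A complex number $\lambda$ is an eigenvalue of $\mathcal{T}$ with eigenvector $\mathbf{x}\neq 0$ if $\lambda x_i^{k-1}=(\mathcal{T}\mathbf{x}^{k-1})_i$ for all $i\in[n]$; if both $\lambda$ and $\mathbf{x}$ are real, $\lambda$ is an H-eigenvalue and $\mathbf{x}$ an H-eigenvector. $\lambda_{\max}(\mathcal{T})$ denotes the largest H-eigenvalue of $\mathcal{T}$ (H-eigenvalues exist if $\mathcal{T}$ is symmetric with $k$ even, or if $\mathcal{T}$ is nonnegative). A vector $\mathbf{x}\in\mathbb{R}^n$ is unit if $\sum_{i\in[n]}|x_i|^k=1$. For nonempty $I\subseteq[n]$, the principal subtensor $\mathcal{T}[I]$ is the tensor of order $k$ and dimension $|I|$ with entries $t_{i_1\ldots i_k}$, $i_1,\dots,i_k\in I$.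
   Formalization: For odd k the eigenvector x is additionally assumed to be nonnegative; without this the lower bound is false, e.g. k=3, n=2, all off-diagonal entries 1, x=-(c,c) with 2c^3=1, I={1} gives 6 ≤ 0. *)

theory Defs
  imports Complex_Main "HOL-Combinatorics.Permutations"
begin

text \<open>
  A tensor of order \<open>k\<close> is a function on index lists of length \<open>k\<close> over a finite index set \<open>A\<close>; its
  dimension is \<open>card A\<close>, and a tensor of dimension \<open>n\<close> has \<open>A = {1..n}\<close>. Values of the tensor (or of
  a vector) at arguments not over \<open>A\<close> are irrelevant. Keeping \<open>A\<close> as a parameter makes the
  principal subtensor \<open>T[I]\<close> the same function \<open>T\<close>, taken with index set \<open>I\<close>.
\<close>

definition tuples :: "nat \<Rightarrow> nat set \<Rightarrow> nat list set" where
  "tuples k A = {is. length is = k \<and> set is \<subseteq> A}"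

definition symmetric_tensor :: "nat \<Rightarrow> nat set \<Rightarrow> (nat list \<Rightarrow> real) \<Rightarrow> bool" where
  "symmetric_tensor k A T \<longleftrightarrow>
     (\<forall>is\<in>tuples k A. \<forall>p. p permutes {..<k} \<longrightarrow> T (permute_list p is) = T is)"

definition zero_diagonal :: "nat \<Rightarrow> nat set \<Rightarrow> (nat list \<Rightarrow> real) \<Rightarrow> bool" where
  "zero_diagonal k A T \<longleftrightarrow> (\<forall>i\<in>A. T (replicate k i) = 0)"

definition nonnegative_tensor :: "nat \<Rightarrow> nat set \<Rightarrow> (nat list \<Rightarrow> real) \<Rightarrow> bool" where
  "nonnegative_tensor k A T \<longleftrightarrow> (\<forall>is\<in>tuples k A. T is \<ge> 0)"

definition nonzero_tensor :: "nat \<Rightarrow> nat set \<Rightarrow> (nat list \<Rightarrow> real) \<Rightarrow> bool" where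
  "nonzero_tensor k A T \<longleftrightarrow> (\<exists>is\<in>tuples k A. T is \<noteq> 0)"

text \<open>The \<open>i\<close>-th entry of \<open>T x\<^sup>k\<^sup>-\<^sup>1\<close>.\<close>

definition tensor_apply ::
  "nat \<Rightarrow> nat set \<Rightarrow> (nat list \<Rightarrow> real) \<Rightarrow> (nat \<Rightarrow> real) \<Rightarrow> nat \<Rightarrow> real" where
  "tensor_apply k A T x i = (\<Sum>js\<in>tuples (k - 1) A. T (i # js) * prod_list (map x js))"

definition H_eigenpair ::
  "nat \<Rightarrow> nat set \<Rightarrow> (nat list \<Rightarrow> real) \<Rightarrow> real \<Rightarrow> (nat \<Rightarrow> real) \<Rightarrow> bool" where
  "H_eigenpair k A T l x \<longleftrightarrow>
     (\<exists>i\<in>A. x i \<noteq> 0) \<and> (\<forall>i\<in>A. l * x i ^ (k - 1) = tensor_apply k A T x i)"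

definition H_eigenvalue :: "nat \<Rightarrow> nat set \<Rightarrow> (nat list \<Rightarrow> real) \<Rightarrow> real \<Rightarrow> bool" where
  "H_eigenvalue k A T l \<longleftrightarrow> (\<exists>x. H_eigenpair k A T l x)"

definition lambda_max :: "nat \<Rightarrow> nat set \<Rightarrow> (nat list \<Rightarrow> real) \<Rightarrow> real" where
  "lambda_max k A T = (GREATEST l. H_eigenvalue k A T l)"

definition unit_vector :: "nat \<Rightarrow> nat set \<Rightarrow> (nat \<Rightarrow> real) \<Rightarrow> bool" where
  "unit_vector k A x \<longleftrightarrow> (\<Sum>i\<in>A. \<bar>x i\<bar> ^ k) = 1"

end

theory Submission
  imports Defs "HOL-Analysis.Function_Topology"
begin

text \<open>
  Write \<open>f\<^sub>A(y)\<close> for the sum of \<open>t\<^bsub>i\<^sub>1\<dots>i\<^sub>k\<^esub> y\<^bsub>i\<^sub>1\<^esub> \<cdots> y\<^bsub>i\<^sub>k\<^esub>\<close> over all indices in \<open>A\<close>. The largest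
  H-eigenvalue is a Rayleigh-type maximum: it is the maximum of \<open>f\<^sub>A\<close> over the unit vectors, where
  for odd \<open>k\<close> only nonnegative unit vectors compete (\<open>lambda_max_variational\<close>). The maximum exists
  by compactness; at a maximizer the derivatives in the coordinate directions give exactly the
  eigenvalue equations (\<open>maximizer_is_eigenvector\<close>); and pairing the eigenvalue equations of any
  eigenvector with the vector itself bounds its eigenvalue by the maximum
  (\<open>eigenvalue_le_bound\<close>).

  Given this, the upper bound is clear, since extending a vector on \<open>I\<close> by zero changes neither
  its norm nor the value of the form (\<open>lambda_max_principal_le\<close>). For the lower bound, restrict the
  eigenvector \<open>x\<close> to \<open>I\<close>, that is, subtract from \<open>x\<close> its part \<open>v\<close> supported outside \<open>I\<close>, and
  expand \<open>f(x - v)\<close> multilinearly. By symmetry only the number \<open>j\<close> of slots that hold \<open>v\<close> matters,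
  which produces the binomial coefficients (\<open>form_add_scaled\<close>). The terms \<open>j = 0\<close> and \<open>j = 1\<close> are
  evaluated by the eigenvalue equations, so the left-hand side of the inequality is exactly
  \<open>f\<^sub>I(x)\<close> (\<open>form_restrict_eigenvector\<close>). By maximality this is at most \<open>\<lambda>\<^sub>m\<^sub>a\<^sub>x(T[I])\<close> times the sum
  of the \<open>x\<^sub>i\<^sup>k\<close> with \<open>i \<in> I\<close>. That sum is at most \<open>1\<close>, and \<open>\<lambda>\<^sub>m\<^sub>a\<^sub>x(T[I])\<close> is nonnegative because a
  zero diagonal makes \<open>f\<^sub>I\<close> vanish at the coordinate vectors (\<open>lambda_max_nonneg\<close>).
\<close>

section \<open>Multilinear expansion of the form of a symmetric tensor\<close>

text \<open>
  The multilinear form of the tensor, with the vector \<open>w p\<close> in slot \<open>p\<close>. Slots are numbered from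
  \<open>0\<close>, as list positions are.
\<close>

definition multilinear ::
  "nat \<Rightarrow> nat set \<Rightarrow> (nat list \<Rightarrow> real) \<Rightarrow> (nat \<Rightarrow> nat \<Rightarrow> real) \<Rightarrow> real" where
  "multilinear k A T w = (\<Sum>is\<in>tuples k A. T is * (\<Prod>p<k. w p (is ! p)))"

definition form :: "nat \<Rightarrow> nat set \<Rightarrow> (nat list \<Rightarrow> real) \<Rightarrow> (nat \<Rightarrow> real) \<Rightarrow> real" where
  "form k A T y = multilinear k A T (\<lambda>_. y)"

lemma finite_tuples: "finite A \<Longrightarrow> finite (tuples k A)"
  using finite_lists_length_eq[of A k] by (simp add: tuples_def conj_commute)

lemma tuples_mono: "A \<subseteq> B \<Longrightarrow> tuples k A \<subseteq> tuples k B"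
  by (auto simp: tuples_def)

lemma nth_in_tuples: "is \<in> tuples k A \<Longrightarrow> p < k \<Longrightarrow> is ! p \<in> A"
  by (auto simp: tuples_def)

lemma tuples_Suc: "tuples (Suc m) A = (\<lambda>(i, js). i # js) ` (A \<times> tuples m A)"
  by (auto simp: tuples_def length_Suc_conv image_iff)

lemma prod_list_map_nth: "prod_list (map f xs) = (\<Prod>p<length xs. f (xs ! p) :: real)"
  by (induction xs) (simp_all add: prod.lessThan_Suc_shift del: prod.lessThan_Suc)

lemma multilinear_cong:
  assumes "\<And>p i. p < k \<Longrightarrow> i \<in> A \<Longrightarrow> w p i = w' p i"
  shows "multilinear k A T w = multilinear k A T w'"
  unfolding multilinear_def
  by (intro sum.cong refl arg_cong2[where f = "(*)"] prod.cong) (auto simp: assms nth_in_tuples)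

lemma form_cong: "(\<And>i. i \<in> A \<Longrightarrow> y i = z i) \<Longrightarrow> form k A T y = form k A T z"
  unfolding form_def by (intro multilinear_cong)

lemma form_scale: "form k A T (\<lambda>i. c * y i) = c ^ k * form k A T y"
  by (simp add: form_def multilinear_def prod.distrib sum_distrib_left mult_ac)

lemma permute_list_in_tuples:
  assumes "is \<in> tuples k A" "\<sigma> permutes {..<k}"
  shows "permute_list \<sigma> is \<in> tuples k A"
  using assms by (auto simp: tuples_def)

lemma bij_betw_permute_list_tuples:
  assumes "\<sigma> permutes {..<k}"
  shows "bij_betw (permute_list \<sigma>) (tuples k A) (tuples k A)"
proof (rule bij_betw_byWitness[where f' = "permute_list (inv \<sigma>)"])
  have inv: "inv \<sigma> permutes {..<k}" using assms by (rule permutes_inv)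
  show "\<forall>is\<in>tuples k A. permute_list (inv \<sigma>) (permute_list \<sigma> is) = is"
    using assms inv by (auto simp: tuples_def permute_list_compose[symmetric] permutes_inv_o)
  show "\<forall>is\<in>tuples k A. permute_list \<sigma> (permute_list (inv \<sigma>) is) = is"
    using assms inv by (auto simp: tuples_def permute_list_compose[symmetric] permutes_inv_o)
qed (use assms permutes_inv[OF assms] permute_list_in_tuples in blast)+

text \<open>
  Permuting the slots amounts to permuting the index lists over which the sum runs, and a symmetric
  tensor does not see that.
\<close>

lemma multilinear_permute:
  assumes "symmetric_tensor k A T" "\<sigma> permutes {..<k}"
  shows "multilinear k A T (w \<circ> \<sigma>) = multilinear k A T w"
proof -
  have inv: "inv \<sigma> permutes {..<k}" using assms(2) by (rule permutes_inv)
  have "multilinear k A T w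
        = (\<Sum>is\<in>tuples k A. T (permute_list (inv \<sigma>) is)
              * (\<Prod>p<k. w p (permute_list (inv \<sigma>) is ! p)))"
    unfolding multilinear_def
    by (rule sum.reindex_bij_betw[OF bij_betw_permute_list_tuples[OF inv], symmetric])
  also have "\<dots> = (\<Sum>is\<in>tuples k A. T is * (\<Prod>p<k. (w \<circ> \<sigma>) p (is ! p)))"
  proof (intro sum.cong refl arg_cong2[where f = "(*)"])
    fix "is" assume is_in: "is \<in> tuples k A"
    show "T (permute_list (inv \<sigma>) is) = T is"
      using assms(1) inv is_in by (simp add: symmetric_tensor_def)
    have len: "length is = k" using is_in by (simp add: tuples_def)
    have "(\<Prod>p<k. w p (permute_list (inv \<sigma>) is ! p)) = (\<Prod>p<k. w p (is ! inv \<sigma> p))"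
      using inv len by (intro prod.cong refl) (simp add: permute_list_nth)
    also have "\<dots> = (\<Prod>p<k. w (\<sigma> p) (is ! inv \<sigma> (\<sigma> p)))"
      using permutes_imp_bij[OF assms(2)]
      by (intro prod.reindex_bij_betw[symmetric, where g = "\<lambda>p. w p (is ! inv \<sigma> p)"])
    also have "\<dots> = (\<Prod>p<k. (w \<circ> \<sigma>) p (is ! p))"
      by (simp add: permutes_inverses(2)[OF assms(2)])
    finally show "(\<Prod>p<k. w p (permute_list (inv \<sigma>) is ! p)) = (\<Prod>p<k. (w \<circ> \<sigma>) p (is ! p))" .
  qed
  finally show ?thesis by (simp add: multilinear_def)
qed

text \<open>
  Combined with \<open>multilinear_permute\<close>, this moves any chosen set of slots to the front, so that the
  value of a symmetric form with \<open>v\<close> in the slots of \<open>P\<close> depends only on \<open>card P\<close>.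
\<close>

lemma permutes_onto_initial_segment:
  assumes "P \<subseteq> {..<k::nat}"
  obtains \<sigma> where "\<sigma> permutes {..<k}" "\<And>p. p < k \<Longrightarrow> \<sigma> p < card P \<longleftrightarrow> p \<in> P"
proof -
  have fin: "finite P" using assms finite_subset by blast
  have le: "card P \<le> k" using card_mono[OF _ assms] by simp
  obtain f where f: "bij_betw f P {..<card P}"
    using finite_same_card_bij[OF fin, of "{..<card P}"] by auto
  obtain g where g: "bij_betw g ({..<k} - P) {card P..<k}"
    using finite_same_card_bij[of "{..<k} - P" "{card P..<k}"] assms fin
    by (auto simp: card_Diff_subset)
  define \<sigma> where "\<sigma> p = (if p \<in> P then f p else if p < k then g p else p)" for p
  have bP: "bij_betw \<sigma> P {..<card P}"
    using f by (subst bij_betw_cong[where g = f]) (auto simp: \<sigma>_def)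
  have bQ: "bij_betw \<sigma> ({..<k} - P) {card P..<k}"
    using g by (subst bij_betw_cong[where g = g]) (auto simp: \<sigma>_def)
  have "bij_betw \<sigma> (P \<union> ({..<k} - P)) ({..<card P} \<union> {card P..<k})"
    by (rule bij_betw_combine[OF bP bQ]) auto
  moreover have "P \<union> ({..<k} - P) = {..<k}" "{..<card P} \<union> {card P..<k} = {..<k}"
    using assms le by auto
  ultimately have "bij_betw \<sigma> {..<k} {..<k}" by simp
  moreover have "\<sigma> p = p" if "p \<notin> {..<k}" for p
    using that assms by (auto simp: \<sigma>_def)
  ultimately have "\<sigma> permutes {..<k}" by (rule bij_imp_permutes)
  moreover have "\<sigma> p < card P \<longleftrightarrow> p \<in> P" if "p < k" for p
    using bij_betwE[OF bP] bij_betwE[OF bQ] that by (cases "p \<in> P") (auto dest!: bspec[of _ _ p])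
  ultimately show ?thesis using that by blast
qed

text \<open>
  Multiplying out puts \<open>v\<close> into the slots of \<open>P\<close> and \<open>y\<close> into the others, once for each set \<open>P\<close> of
  slots. By symmetry the \<open>k choose j\<close> sets of size \<open>j\<close> contribute equally.
\<close>

lemma form_add:
  assumes "symmetric_tensor k A T"
  shows "form k A T (\<lambda>i. v i + y i)
         = (\<Sum>j\<le>k. real (k choose j) * multilinear k A T (\<lambda>p. if p < j then v else y))"
proof -
  define F where "F P = multilinear k A T (\<lambda>p. if p \<in> P then v else y)" for P
  define G where "G j = multilinear k A T (\<lambda>p. if p < j then v else y)" for j :: nat
  \<comment> \<open>The contribution of a set of slots depends only on its size.\<close>
  have FG: "F P = G (card P)" if P: "P \<subseteq> {..<k}" for P
  proof -
    obtain \<sigma> where \<sigma>: "\<sigma> permutes {..<k}" "\<And>p. p < k \<Longrightarrow> \<sigma> p < card P \<longleftrightarrow> p \<in> P"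
      using permutes_onto_initial_segment[OF P] by blast
    have "F P = multilinear k A T ((\<lambda>p. if p < card P then v else y) \<circ> \<sigma>)"
      unfolding F_def by (rule multilinear_cong) (simp add: \<sigma>(2))
    then show ?thesis using multilinear_permute[OF assms \<sigma>(1)] by (simp add: G_def)
  qed
  have "form k A T (\<lambda>i. v i + y i)
        = (\<Sum>is\<in>tuples k A. T is * (\<Sum>P\<in>Pow {..<k}. \<Prod>p<k. (if p \<in> P then v else y) (is ! p)))"
    unfolding form_def multilinear_def
  proof (intro sum.cong refl arg_cong2[where f = "(*)"])
    fix "is" :: "nat list"
    have "(\<Prod>p<k. v (is ! p) + y (is ! p))
          = (\<Sum>P\<in>Pow {..<k}. (\<Prod>p\<in>P. v (is ! p)) * (\<Prod>p\<in>{..<k} - P. y (is ! p)))"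
      by (rule prod_add) simp
    also have "\<dots> = (\<Sum>P\<in>Pow {..<k}. \<Prod>p<k. (if p \<in> P then v else y) (is ! p))"
    proof (rule sum.cong[OF refl])
      fix P assume "P \<in> Pow {..<k}"
      then have P: "P \<subseteq> {..<k}" by simp
      have "(\<Prod>p<k. (if p \<in> P then v else y) (is ! p))
            = (\<Prod>p\<in>{..<k} - P. (if p \<in> P then v else y) (is ! p))
              * (\<Prod>p\<in>P. (if p \<in> P then v else y) (is ! p))"
        by (rule prod.subset_diff[OF P]) simp
      then show "(\<Prod>p\<in>P. v (is ! p)) * (\<Prod>p\<in>{..<k} - P. y (is ! p))
                 = (\<Prod>p<k. (if p \<in> P then v else y) (is ! p))"
        by simp
    qed
    finally show "(\<Prod>p<k. v (is ! p) + y (is ! p))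
                  = (\<Sum>P\<in>Pow {..<k}. \<Prod>p<k. (if p \<in> P then v else y) (is ! p))" .
  qed
  also have "\<dots> = (\<Sum>P\<in>Pow {..<k}. F P)"
    unfolding F_def multilinear_def sum_distrib_left by (rule sum.swap)
  also have "\<dots> = (\<Sum>P\<in>Pow {..<k}. G (card P))"
    by (rule sum.cong) (auto simp: FG)
  also have "\<dots> = (\<Sum>j\<le>k. \<Sum>P\<in>{P \<in> Pow {..<k}. card P = j}. G (card P))"
    by (rule sum.group[symmetric]) (auto intro: order_trans[OF card_mono[of "{..<k}"]])
  also have "\<dots> = (\<Sum>j\<le>k. real (k choose j) * G j)"
    using n_subsets[of "{..<k}"] by (intro sum.cong refl) simp
  finally show ?thesis by (simp add: G_def)
qed

lemma multilinear_first_slot: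
  assumes "0 < k"
  shows "multilinear k A T (\<lambda>p. if p < 1 then v else y) = (\<Sum>i\<in>A. v i * tensor_apply k A T y i)"
proof -
  obtain m where k: "k = Suc m" using assms gr0_conv_Suc by auto
  let ?g = "\<lambda>is. T is * (\<Prod>p<k. (if p < 1 then v else y) (is ! p))"
  have "sum ?g (tuples k A) = sum (?g \<circ> (\<lambda>(i, js). i # js)) (A \<times> tuples m A)"
    unfolding k tuples_Suc by (rule sum.reindex) (auto simp: inj_on_def)
  also have "\<dots> = (\<Sum>(i, js)\<in>A \<times> tuples m A. v i * (T (i # js) * prod_list (map y js)))"
    unfolding k
    by (intro sum.cong refl)
       (auto simp: prod.lessThan_Suc_shift prod_list_map_nth tuples_def simp del: prod.lessThan_Suc)
  also have "\<dots> = (\<Sum>i\<in>A. v i * tensor_apply k A T y i)"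
    by (simp add: k tensor_apply_def sum_distrib_left sum.cartesian_product)
  finally show ?thesis by (simp add: multilinear_def)
qed

lemma form_Euler: "0 < k \<Longrightarrow> form k A T y = (\<Sum>i\<in>A. y i * tensor_apply k A T y i)"
  using multilinear_first_slot[of k A T y y] by (simp add: form_def)

text \<open>
  The coefficients here do not involve \<open>c\<close>. For a coordinate vector \<open>v\<close> this is the Taylor expansion
  used for differentiating the form; for \<open>c = -1\<close> it is the alternating sum of the main inequality.
\<close>

lemma form_add_scaled:
  assumes "symmetric_tensor k A T"
  shows "form k A T (\<lambda>i. y i + c * v i)
         = (\<Sum>j\<le>k. real (k choose j) * multilinear k A T (\<lambda>p. if p < j then v else y) * c ^ j)"
proof -
  have "multilinear k A T (\<lambda>p. if p < j then (\<lambda>i. c * v i) else y)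
        = multilinear k A T (\<lambda>p. if p < j then v else y) * c ^ j" if "j \<le> k" for j
  proof -
    have "(\<Prod>p<k. (if p < j then (\<lambda>i. c * v i) else y) (is ! p))
          = (\<Prod>p<k. (if p < j then v else y) (is ! p)) * c ^ j" for "is"
    proof -
      have "(\<Prod>p<k. (if p < j then (\<lambda>i. c * v i) else y) (is ! p))
            = (\<Prod>p<k. (if p < j then v else y) (is ! p) * (if p < j then c else 1))"
        by (intro prod.cong) auto
      also have "\<dots> = (\<Prod>p<k. (if p < j then v else y) (is ! p)) * (\<Prod>p<k. if p < j then c else 1)"
        by (rule prod.distrib)
      also have "(\<Prod>p<k. if p < j then c else 1) = (\<Prod>p<j. c)"
        using that by (intro prod.mono_neutral_cong_right) auto
      finally show ?thesis by simp
    qed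
    then show ?thesis by (simp add: multilinear_def sum_distrib_right mult.assoc)
  qed
  then show ?thesis
    using form_add[OF assms, of "\<lambda>i. c * v i" y] by (simp add: add.commute mult.assoc)
qed

section \<open>Maximizing the form over unit vectors\<close>

text \<open>
  The cone over which the form is maximized. Restricting to nonnegative vectors for odd \<open>k\<close> makes
  \<open>y\<^sub>i\<^sup>k\<close> and \<open>\<bar>y\<^sub>i\<bar>\<^sup>k\<close> agree on the cone for every \<open>k\<close>, so that both parities can be treated alike.
\<close>

definition admissible :: "nat \<Rightarrow> nat set \<Rightarrow> (nat \<Rightarrow> real) \<Rightarrow> bool" where
  "admissible k A y \<longleftrightarrow> (odd k \<longrightarrow> (\<forall>i\<in>A. 0 \<le> y i))"

lemma admissible_abs_power: "admissible k A y \<Longrightarrow> i \<in> A \<Longrightarrow> \<bar>y i\<bar> ^ k = y i ^ k"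
  by (cases "even k") (auto simp: admissible_def power_even_abs)

text \<open>
  Setting the irrelevant values outside \<open>A\<close> to zero places the admissible unit vectors as a closed
  set inside the cube \<open>[-1, 1]\<^sup>A\<close>, padded by singletons, which is compact by Tychonoff's theorem.
\<close>

lemma form_attains_max_on_unit:
  assumes "finite A" "A \<noteq> {}" "0 < k"
  obtains y where "admissible k A y" "unit_vector k A y"
    "\<And>z. admissible k A z \<Longrightarrow> unit_vector k A z \<Longrightarrow> form k A T z \<le> form k A T y"
proof -
  define S where "S = {y. (\<forall>i. i \<notin> A \<longrightarrow> y i = 0) \<and> admissible k A y \<and> unit_vector k A y}"
  define K where "K = (\<Pi>\<^sub>E i\<in>UNIV. if i \<in> A then {-1..1} else {0::real})"
  have "compactin (product_topology (\<lambda>_. euclidean) UNIV) K"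
    unfolding K_def by (subst compactin_PiE) auto
  then have K: "compact K" by (simp add: euclidean_product_topology)
  have S_K: "S \<subseteq> K"
  proof
    fix y assume y: "y \<in> S"
    have "\<bar>y i\<bar> \<le> 1" if i: "i \<in> A" for i
    proof -
      have "\<bar>y i\<bar> ^ k \<le> (\<Sum>i\<in>A. \<bar>y i\<bar> ^ k)" using assms(1) i by (intro member_le_sum) auto
      then have "\<bar>y i\<bar> ^ k \<le> 1 ^ k" using y by (simp add: S_def unit_vector_def)
      then show ?thesis using assms(3) power_mono_iff[of "\<bar>y i\<bar>" 1 k] by simp
    qed
    then show "y \<in> K" using y by (auto simp: K_def S_def PiE_iff abs_le_iff)
  qed
  have "closed S"
    unfolding S_def admissible_def unit_vector_def Ball_def
    by (intro closed_Collect_conj closed_Collect_all closed_Collect_imp closed_Collect_eq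
        closed_Collect_le open_Collect_const continuous_intros continuous_on_product_coordinates)
  then have cS: "compact S" using K S_K by (metis closed_Int_compact inf.absorb_iff1)
  obtain a where a: "a \<in> A" using assms(2) by blast
  have "\<bar>if i = a then 1 else 0 :: real\<bar> ^ k = (if i = a then 1 else 0)" for i
    using assms(3) by simp
  then have "(\<lambda>i. if i = a then 1 else 0) \<in> S"
    using a assms(1) by (simp add: S_def admissible_def unit_vector_def)
  then have neS: "S \<noteq> {}" by blast
  have "continuous_on S (form k A T)"
    unfolding form_def multilinear_def
    by (intro continuous_intros continuous_on_subset[OF continuous_on_product_coordinates]) auto
  then obtain y where y: "y \<in> S" "\<And>z. z \<in> S \<Longrightarrow> form k A T z \<le> form k A T y"
    using continuous_attains_sup[OF cS neS] by blast
  have "form k A T z \<le> form k A T y" if z: "admissible k A z" "unit_vector k A z" for z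
  proof -
    let ?z = "\<lambda>i. if i \<in> A then z i else 0"
    have "?z \<in> S" using z by (auto simp: S_def admissible_def unit_vector_def)
    moreover have "form k A T ?z = form k A T z" by (rule form_cong) simp
    ultimately show ?thesis using y(2) by fastforce
  qed
  then show ?thesis using that y(1) by (auto simp: S_def)
qed

text \<open>
  The bound on unit vectors extends to the whole cone because both sides are homogeneous of
  degree \<open>k\<close>.
\<close>

lemma form_le_unit_bound:
  assumes "finite A" "0 < k" "admissible k A z"
    and bound: "\<And>u. admissible k A u \<Longrightarrow> unit_vector k A u \<Longrightarrow> form k A T u \<le> M"
  shows "form k A T z \<le> M * (\<Sum>i\<in>A. z i ^ k)"
proof -
  define N where "N = (\<Sum>i\<in>A. \<bar>z i\<bar> ^ k)"
  have N: "N = (\<Sum>i\<in>A. z i ^ k)"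
    unfolding N_def by (intro sum.cong refl admissible_abs_power[OF assms(3)])
  have "N \<ge> 0" by (simp add: N_def sum_nonneg)
  then consider "N = 0" | "N > 0" by linarith
  then show ?thesis
  proof cases
    case 1
    then have "\<bar>z i\<bar> ^ k = 0" if "i \<in> A" for i
      using that assms(1) unfolding N_def by (subst (asm) sum_nonneg_eq_0_iff) auto
    then have "form k A T z = form k A T (\<lambda>i. 0 * z i)" using assms(2) by (intro form_cong) simp
    also have "\<dots> = 0" using assms(2) by (subst form_scale) simp
    finally show ?thesis using 1 N by simp
  next
    case 2
    define r where "r = root k N"
    have r: "r > 0" "r ^ k = N" using 2 assms(2) by (simp_all add: r_def)
    let ?u = "\<lambda>i. inverse r * z i"
    have "(\<Sum>i\<in>A. \<bar>?u i\<bar> ^ k) = inverse N * N"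
      using r by (simp add: N_def sum_distrib_left abs_mult power_mult_distrib power_inverse)
    then have "unit_vector k A ?u" using 2 by (simp add: unit_vector_def)
    moreover have "admissible k A ?u" using assms(3) r by (auto simp: admissible_def)
    ultimately have "form k A T ?u \<le> M" by (rule bound[rotated])
    then have "inverse N * form k A T z \<le> M" using r by (simp add: form_scale power_inverse)
    then show ?thesis using 2 N by (simp add: field_simps)
  qed
qed

section \<open>The largest H-eigenvalue as a maximum\<close>

lemma DERIV_polynomial_at_0:
  fixes a :: "nat \<Rightarrow> real"
  assumes "0 < k"
  shows "((\<lambda>t. \<Sum>j\<le>k. a j * t ^ j) has_real_derivative a 1) (at 0)"
proof -
  have "((\<lambda>t. \<Sum>j\<le>k. a j * t ^ j) has_real_derivative
          (\<Sum>j\<le>k. a j * (real j * 0 ^ (j - 1)))) (at 0)"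
    by (auto intro!: derivative_eq_intros sum.cong)
  also have "(\<Sum>j\<le>k. a j * (real j * 0 ^ (j - 1))) = (\<Sum>j\<in>{1}. a j * (real j * 0 ^ (j - 1)))"
    using assms by (intro sum.mono_neutral_right) (auto simp: power_0_left)
  finally show ?thesis by simp
qed

text \<open>
  Let \<open>M = f(y)\<close>. Moving from \<open>y\<close> along the coordinate vector \<open>e\<^sub>i\<close>, the nonnegative difference
  \<open>g t = M \<Sum>\<^sub>a (y + t e\<^sub>i)\<^sub>a\<^sup>k - f(y + t e\<^sub>i)\<close> vanishes at \<open>t = 0\<close>, and up to the factor \<open>k\<close> its
  derivative there is the defect in the \<open>i\<close>-th eigenvalue equation. If the cone contains both
  directions, the derivative is zero. Otherwise \<open>k\<close> is odd and \<open>y\<^sub>i = 0\<close>: only \<open>t \<ge> 0\<close> is possible,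
  which gives \<open>(T y\<^sup>k\<^sup>-\<^sup>1)\<^sub>i \<le> 0\<close>, and the nonnegativity of the tensor supplies the converse.
\<close>

lemma maximizer_is_eigenvector:
  assumes "finite A" "2 \<le> k" "symmetric_tensor k A T" "even k \<or> nonnegative_tensor k A T"
    and adm: "admissible k A y" and unit: "unit_vector k A y"
    and bound: "\<And>z. admissible k A z \<Longrightarrow> form k A T z \<le> form k A T y * (\<Sum>i\<in>A. z i ^ k)"
  shows "H_eigenpair k A T (form k A T y) y"
proof -
  define M where "M = form k A T y"
  have k: "0 < k" using assms(2) by simp
  have one: "(\<Sum>i\<in>A. y i ^ k) = 1"
    using unit admissible_abs_power[OF adm] by (simp add: unit_vector_def)
  have "M * y i ^ (k - 1) = tensor_apply k A T y i" if i: "i \<in> A" for i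
  proof -
    define e :: "nat \<Rightarrow> real" where "e a = (if a = i then 1 else 0)" for a
    define z where "z t a = y a + t * e a" for t a
    define g where "g t = M * (\<Sum>a\<in>A. z t a ^ k) - form k A T (z t)" for t
    define D where "D = real k * (M * y i ^ (k - 1) - tensor_apply k A T y i)"
    have "z 0 = y" by (simp add: z_def fun_eq_iff)
    then have g0: "g 0 = 0" by (simp add: g_def one M_def)
    have nonneg: "g t \<ge> 0" if "admissible k A (z t)" for t
      using bound[OF that] by (simp add: g_def M_def)
    have "multilinear k A T (\<lambda>p. if p < 1 then e else y) = tensor_apply k A T y i"
      using i assms(1) multilinear_first_slot[OF k, of A T e y]
      by (simp add: e_def if_distrib[of "\<lambda>c. c * _"] cong: if_cong)
    then have form_der: "((\<lambda>t. form k A T (z t)) has_real_derivative real k * tensor_apply k A T y i) (at 0)"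
      using DERIV_polynomial_at_0[OF k, of "\<lambda>j. real (k choose j) *
              multilinear k A T (\<lambda>p. if p < j then e else y)"]
      by (simp add: z_def[abs_def] form_add_scaled[OF assms(3)])
    have norm_der: "((\<lambda>t. M * (\<Sum>a\<in>A. z t a ^ k)) has_real_derivative
                     M * (\<Sum>a\<in>A. real k * y a ^ (k - 1) * e a)) (at 0)"
      unfolding z_def by (auto intro!: derivative_eq_intros sum.cong)
    have "(\<Sum>a\<in>A. real k * y a ^ (k - 1) * e a) = real k * y i ^ (k - 1)"
      using i assms(1) by (simp add: e_def if_distrib cong: if_cong)
    then have der: "(g has_real_derivative D) (at 0)"
      using DERIV_diff[OF norm_der form_der] by (simp add: g_def[abs_def] D_def algebra_simps)
    have D_ge: "D \<ge> 0"
    proof (rule ccontr)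
      assume "\<not> D \<ge> 0"
      then obtain d where d: "d > 0" "\<And>h. 0 < h \<Longrightarrow> h < d \<Longrightarrow> g (0 + h) < g 0"
        using DERIV_neg_dec_right[OF der] by auto
      have "admissible k A (z (d / 2))"
        using adm d(1) by (auto simp: admissible_def z_def e_def)
      then show False using nonneg d(2)[of "d / 2"] d(1) g0 by fastforce
    qed
    have D_le: "D \<le> 0" if inner: "even k \<or> y i > 0"
    proof (rule ccontr)
      assume "\<not> D \<le> 0"
      then obtain d where d: "d > 0" "\<And>h. 0 < h \<Longrightarrow> h < d \<Longrightarrow> g (0 - h) < g 0"
        using DERIV_pos_inc_left[OF der] by auto
      \<comment> \<open>For odd \<open>k\<close> the step back must not leave the nonnegative cone.\<close>
      define h where "h = (if even k then d / 2 else min (d / 2) (y i))"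
      have h: "0 < h" "h < d" "even k \<or> h \<le> y i" using d(1) inner by (auto simp: h_def)
      have "admissible k A (z (- h))"
        using adm h(3) by (auto simp: admissible_def z_def e_def)
      then show False using nonneg d(2)[OF h(1,2)] g0 by fastforce
    qed
    show ?thesis
    proof (cases "even k \<or> y i > 0")
      case True
      then have "D = 0" using D_ge D_le by linarith
      then show ?thesis using k by (simp add: D_def)
    next
      case False
      then have y0: "y i = 0" and T: "nonnegative_tensor k A T" and y: "\<And>a. a \<in> A \<Longrightarrow> 0 \<le> y a"
        using adm i assms(4) by (force simp: admissible_def)+
      have "0 \<le> tensor_apply k A T y i"
        unfolding tensor_apply_def
      proof (intro sum_nonneg mult_nonneg_nonneg prod_list_nonneg)
        fix js assume js: "js \<in> tuples (k - 1) A"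
        then have "i # js \<in> tuples k A" using i k by (auto simp: tuples_def)
        then show "0 \<le> T (i # js)" using T by (simp add: nonnegative_tensor_def)
        show "0 \<le> c" if "c \<in> set (map y js)" for c
          using that js y by (auto simp: tuples_def)
      qed
      moreover have "tensor_apply k A T y i \<le> 0"
        using D_ge y0 assms(2) k by (simp add: D_def power_0_left mult_le_0_iff)
      ultimately show ?thesis using y0 assms(2) by (simp add: power_0_left)
    qed
  qed
  moreover have "\<exists>i\<in>A. y i \<noteq> 0"
  proof (rule ccontr)
    assume "\<not> (\<exists>i\<in>A. y i \<noteq> 0)"
    then have "(\<Sum>i\<in>A. y i ^ k) = 0" using k by (intro sum.neutral) (simp add: power_0_left)
    then show False using one by simp
  qed
  ultimately show ?thesis by (simp add: H_eigenpair_def M_def)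
qed

text \<open>
  Summing the eigenvalue equations multiplied by \<open>x\<^sub>i\<close> gives \<open>l \<Sum> x\<^sub>i\<^sup>k = f(x)\<close>. For odd \<open>k\<close> the
  eigenvector may have entries of both signs; passing to absolute values keeps the left-hand sides
  \<open>l x\<^sub>i\<^sup>k\<^sup>-\<^sup>1\<close>, since \<open>k - 1\<close> is even, and can only increase the right-hand sides of a nonnegative tensor.
\<close>

lemma eigenvalue_le_bound:
  assumes "finite A" "2 \<le> k" "even k \<or> nonnegative_tensor k A T"
    and bound: "\<And>z. admissible k A z \<Longrightarrow> form k A T z \<le> M * (\<Sum>i\<in>A. z i ^ k)"
    and "H_eigenpair k A T l x"
  shows "l \<le> M"
proof -
  define z where "z i = (if even k then x i else \<bar>x i\<bar>)" for i
  have k: "0 < k" using assms(2) by simp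
  have eig: "l * x i ^ (k - 1) = tensor_apply k A T x i" if "i \<in> A" for i
    using assms(5) that by (simp add: H_eigenpair_def)
  have adm: "admissible k A z" by (simp add: admissible_def z_def)
  have "l * z i ^ k \<le> z i * tensor_apply k A T z i" if i: "i \<in> A" for i
  proof -
    have "l * z i ^ (k - 1) = tensor_apply k A T z i \<or>
          odd k \<and> l * z i ^ (k - 1) \<le> tensor_apply k A T z i"
    proof (cases "even k")
      case True
      then show ?thesis using eig[OF i] by (simp add: z_def[abs_def])
    next
      case False
      have "l * z i ^ (k - 1) = tensor_apply k A T x i"
        using False eig[OF i] by (simp add: z_def power_even_abs)
      also have "\<dots> \<le> tensor_apply k A T z i"
        unfolding tensor_apply_def
      proof (intro sum_mono mult_left_mono)
        fix js assume "js \<in> tuples (k - 1) A"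
        then have "i # js \<in> tuples k A" using i k by (auto simp: tuples_def)
        then show "0 \<le> T (i # js)" using False assms(3) by (simp add: nonnegative_tensor_def)
        have "prod_list (map x js) \<le> \<bar>prod_list (map x js)\<bar>" by simp
        also have "\<dots> = prod_list (map z js)"
          using False by (simp add: prod_list_map_nth abs_prod z_def)
        finally show "prod_list (map x js) \<le> prod_list (map z js)" .
      qed
      finally show ?thesis using False by simp
    qed
    moreover have "odd k \<longrightarrow> 0 \<le> z i" by (simp add: z_def)
    ultimately have "z i * (l * z i ^ (k - 1)) \<le> z i * tensor_apply k A T z i"
      using mult_left_mono by auto
    then show ?thesis using k by (simp add: power_eq_if mult_ac)
  qed
  then have "l * (\<Sum>i\<in>A. z i ^ k) \<le> form k A T z"
    using k by (simp add: form_Euler sum_distrib_left sum_mono)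
  also have "\<dots> \<le> M * (\<Sum>i\<in>A. z i ^ k)" by (rule bound[OF adm])
  finally have "l * (\<Sum>i\<in>A. z i ^ k) \<le> M * (\<Sum>i\<in>A. z i ^ k)" .
  moreover have "(\<Sum>i\<in>A. z i ^ k) > 0"
  proof -
    obtain a where a: "a \<in> A" "x a \<noteq> 0" using assms(5) by (auto simp: H_eigenpair_def)
    then have "0 < \<bar>z a\<bar> ^ k" by (simp add: z_def)
    then have "0 < (\<Sum>i\<in>A. \<bar>z i\<bar> ^ k)" by (intro sum_pos2[OF assms(1) a(1)]) auto
    then show ?thesis by (simp add: admissible_abs_power[OF adm])
  qed
  ultimately show ?thesis by simp
qed

text \<open>
  This also shows that a largest H-eigenvalue exists, so that the \<open>GREATEST\<close> in the definition of
  \<open>lambda_max\<close> denotes it.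
\<close>

lemma lambda_max_variational:
  assumes "finite A" "A \<noteq> {}" "2 \<le> k" "symmetric_tensor k A T"
    "even k \<or> nonnegative_tensor k A T"
  shows lambda_max_attained:
      "\<exists>y. admissible k A y \<and> unit_vector k A y \<and> form k A T y = lambda_max k A T"
    and form_le_lambda_max:
      "admissible k A z \<Longrightarrow> form k A T z \<le> lambda_max k A T * (\<Sum>i\<in>A. z i ^ k)"
proof -
  have k: "0 < k" using assms(3) by simp
  obtain y where y: "admissible k A y" "unit_vector k A y"
    "\<And>z. admissible k A z \<Longrightarrow> unit_vector k A z \<Longrightarrow> form k A T z \<le> form k A T y"
    using form_attains_max_on_unit[OF assms(1,2) k] by blast
  have bound: "form k A T z \<le> form k A T y * (\<Sum>i\<in>A. z i ^ k)" if "admissible k A z" for z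
    using form_le_unit_bound[OF assms(1) k that y(3)] .
  have "lambda_max k A T = form k A T y"
    unfolding lambda_max_def
  proof (rule Greatest_equality)
    show "H_eigenvalue k A T (form k A T y)"
      using maximizer_is_eigenvector[OF assms(1,3,4,5) y(1,2) bound]
      by (auto simp: H_eigenvalue_def)
    show "l \<le> form k A T y" if "H_eigenvalue k A T l" for l
      using that eigenvalue_le_bound[OF assms(1,3,5) bound] by (auto simp: H_eigenvalue_def)
  qed
  then show "\<exists>y. admissible k A y \<and> unit_vector k A y \<and> form k A T y = lambda_max k A T"
    and "admissible k A z \<Longrightarrow> form k A T z \<le> lambda_max k A T * (\<Sum>i\<in>A. z i ^ k)"
    using y bound by auto
qed

section \<open>Principal subtensors\<close>

lemma form_extend_by_zero:
  assumes "finite A" "I \<subseteq> A"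
  shows "form k A T (\<lambda>i. if i \<in> I then y i else 0) = form k I T y"
  unfolding form_def multilinear_def
proof (rule sum.mono_neutral_cong_right)
  show "\<forall>is\<in>tuples k A - tuples k I. T is * (\<Prod>p<k. if is ! p \<in> I then y (is ! p) else 0) = 0"
  proof
    fix "is" assume "is \<in> tuples k A - tuples k I"
    then have "\<exists>p<k. is ! p \<notin> I" by (auto simp: tuples_def subset_iff in_set_conv_nth)
    then show "T is * (\<Prod>p<k. if is ! p \<in> I then y (is ! p) else 0) = 0"
      by (auto intro!: prod_zero)
  qed
qed (use assms in \<open>auto simp: finite_tuples nth_in_tuples intro: subsetD[OF tuples_mono]\<close>)

lemma form_coordinate_vector:
  assumes "finite A" "i \<in> A"
  shows "form k A T (\<lambda>a. if a = i then 1 else 0) = T (replicate k i)"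
proof -
  have "tuples k {i} = {replicate k i}"
    by (auto simp: tuples_def intro!: replicate_eqI)
  moreover have "form k A T (\<lambda>a. if a \<in> {i} then 1 else 0) = form k {i} T (\<lambda>_. 1)"
    using assms by (intro form_extend_by_zero) auto
  ultimately show ?thesis by (simp add: form_def multilinear_def)
qed

text \<open>
  The form takes the value \<open>t\<^bsub>i\<dots>i\<^esub> = 0\<close> at a coordinate vector, which is an admissible unit vector.
\<close>

lemma lambda_max_nonneg:
  assumes "finite A" "A \<noteq> {}" "2 \<le> k" "symmetric_tensor k A T"
    "even k \<or> nonnegative_tensor k A T" "zero_diagonal k A T"
  shows "0 \<le> lambda_max k A T"
proof -
  obtain i where i: "i \<in> A" using assms(2) by blast
  let ?e = "\<lambda>a. if a = i then 1 else 0 :: real"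
  have "form k A T ?e \<le> lambda_max k A T * (\<Sum>a\<in>A. ?e a ^ k)"
    by (rule form_le_lambda_max[OF assms(1-5)]) (simp add: admissible_def)
  moreover have "(\<Sum>a\<in>A. ?e a ^ k) = (\<Sum>a\<in>A. ?e a)"
    using assms(3) by (intro sum.cong) auto
  moreover have "form k A T ?e = 0"
    using form_coordinate_vector[OF assms(1) i] assms(6) i by (simp add: zero_diagonal_def)
  ultimately show ?thesis using i assms(1) by simp
qed

lemma lambda_max_principal_le:
  assumes "finite A" "I \<subseteq> A" "I \<noteq> {}" "2 \<le> k"
    and symA: "symmetric_tensor k A T" and nnA: "even k \<or> nonnegative_tensor k A T"
    and symI: "symmetric_tensor k I T" and nnI: "even k \<or> nonnegative_tensor k I T"
  shows "lambda_max k I T \<le> lambda_max k A T"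
proof -
  have finI: "finite I" using assms(1,2) finite_subset by blast
  obtain y where y: "admissible k I y" "unit_vector k I y" "form k I T y = lambda_max k I T"
    using lambda_max_attained[OF finI assms(3,4) symI nnI] by blast
  let ?z = "\<lambda>i. if i \<in> I then y i else 0"
  have "admissible k A ?z" using y(1) by (simp add: admissible_def)
  moreover have "A \<noteq> {}" using assms(2,3) by blast
  ultimately have "form k A T ?z \<le> lambda_max k A T * (\<Sum>i\<in>A. ?z i ^ k)"
    using form_le_lambda_max[OF assms(1) _ assms(4) symA nnA] by blast
  also have "(\<Sum>i\<in>A. ?z i ^ k) = (\<Sum>i\<in>I. \<bar>y i\<bar> ^ k)"
    using assms(1,2,4) admissible_abs_power[OF y(1)]
    by (intro sum.mono_neutral_cong_right) (auto simp: power_0_left)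
  also have "\<dots> = 1" using y(2) by (simp add: unit_vector_def)
  finally show ?thesis using y(3) form_extend_by_zero[OF assms(1,2)] by simp
qed

text \<open>
  An index list with one of its first \<open>j\<close> entries outside \<open>J\<close> contributes a factor zero. This turns
  the mixed terms of the expansion into sums over restricted index lists.
\<close>

lemma multilinear_indicator_prefix:
  assumes "finite A" "j \<le> k"
  shows "multilinear k A T (\<lambda>p. if p < j then (\<lambda>i. if i \<in> J then x i else 0) else x)
         = (\<Sum>is | is \<in> tuples k A \<and> set (take j is) \<subseteq> J. T is * prod_list (map x is))"
  unfolding multilinear_def
proof (rule sum.mono_neutral_cong_right)
  show "finite (tuples k A)" using assms(1) by (rule finite_tuples)
  have prefix: "set (take j is) \<subseteq> J \<longleftrightarrow> (\<forall>p<j. is ! p \<in> J)" if "is \<in> tuples k A" for "is"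
    using that assms(2) by (auto simp: tuples_def in_set_conv_nth subset_iff)
  show "\<forall>is\<in>tuples k A - {is. is \<in> tuples k A \<and> set (take j is) \<subseteq> J}.
          T is * (\<Prod>p<k. (if p < j then \<lambda>i. if i \<in> J then x i else 0 else x) (is ! p)) = 0"
  proof
    fix "is" assume "is \<in> tuples k A - {is. is \<in> tuples k A \<and> set (take j is) \<subseteq> J}"
    then obtain p where "p < j" "is ! p \<notin> J" using prefix by auto
    then show "T is * (\<Prod>p<k. (if p < j then \<lambda>i. if i \<in> J then x i else 0 else x) (is ! p)) = 0"
      using assms(2) by (auto intro!: prod_zero bexI[of _ p])
  qed
  show "T is * (\<Prod>p<k. (if p < j then \<lambda>i. if i \<in> J then x i else 0 else x) (is ! p))
        = T is * prod_list (map x is)" if "is \<in> {is. is \<in> tuples k A \<and> set (take j is) \<subseteq> J}" for "is"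
  proof -
    have "length is = k" using that by (simp add: tuples_def)
    then show ?thesis
      using that prefix by (auto simp: prod_list_map_nth intro!: prod.cong)
  qed
qed auto

text \<open>
  The restriction of \<open>x\<close> to \<open>I\<close> is \<open>x - v\<close>, where \<open>v\<close> is the part of \<open>x\<close> outside \<open>I\<close>. In the
  expansion of \<open>f(x - v)\<close> the first two terms are known: \<open>f(x) = l\<close>, and the term linear in \<open>v\<close>
  pairs \<open>v\<close> with the eigenvalue equations. The remaining terms form the sum over \<open>j\<close>, where \<open>j + 1\<close>
  is the number of slots that hold \<open>v\<close>.
\<close>

lemma form_restrict_eigenvector:
  assumes "finite A" "I \<subseteq> A" "2 \<le> k" "symmetric_tensor k A T"
    and eig: "H_eigenpair k A T l x" and one: "(\<Sum>i\<in>A. x i ^ k) = 1"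
  shows "form k I T x
         = l * (1 - real k * (\<Sum>i\<in>A - I. x i ^ k))
           - (\<Sum>j=1..k-1. (-1) ^ j * real (k choose (j + 1)) *
               (\<Sum>is | is \<in> tuples k A \<and> set (take (j + 1) is) \<subseteq> A - I. T is * prod_list (map x is)))"
proof -
  define v where "v i = (if i \<in> A - I then x i else 0)" for i
  define c where "c j = multilinear k A T (\<lambda>p. if p < j then v else x)" for j
  have k: "0 < k" using assms(3) by simp
  have apply_x: "x i * tensor_apply k A T x i = l * x i ^ k" if "i \<in> A" for i
    using eig that k by (auto simp: H_eigenpair_def power_eq_if simp flip: mult.assoc)
  have "c 0 = (\<Sum>i\<in>A. l * x i ^ k)"
    using form_Euler[OF k, of A T x] apply_x by (simp add: c_def form_def)
  then have c0: "c 0 = l" using one by (simp flip: sum_distrib_left)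
  have "c 1 = (\<Sum>i\<in>A. v i * tensor_apply k A T x i)"
    unfolding c_def by (rule multilinear_first_slot[OF k])
  also have "\<dots> = (\<Sum>i\<in>A - I. l * x i ^ k)"
    using assms(1) apply_x by (intro sum.mono_neutral_cong_right) (auto simp: v_def)
  finally have c1: "c 1 = l * (\<Sum>i\<in>A - I. x i ^ k)" by (simp add: sum_distrib_left)
  have c_tail: "c j = (\<Sum>is | is \<in> tuples k A \<and> set (take j is) \<subseteq> A - I. T is * prod_list (map x is))"
    if "j \<le> k" for j
    using multilinear_indicator_prefix[OF assms(1) that, of T "A - I" x]
    by (simp add: c_def v_def[abs_def] if_distrib cong: if_cong)
  have "form k I T x = form k A T (\<lambda>i. x i + (-1) * v i)"
    unfolding form_extend_by_zero[OF assms(1,2), symmetric]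
    by (rule form_cong) (simp add: v_def)
  also have "\<dots> = (\<Sum>j\<le>k. real (k choose j) * c j * (-1) ^ j)"
    unfolding c_def by (rule form_add_scaled[OF assms(4)])
  also have "{..k} = insert 0 (insert 1 {2..k})" using assms(3) by auto
  also have "(\<Sum>j\<in>insert 0 (insert 1 {2..k}). real (k choose j) * c j * (-1) ^ j)
             = c 0 - real k * c 1 + (\<Sum>j=2..k. real (k choose j) * c j * (-1) ^ j)"
    by simp
  also have "(\<Sum>j=2..k. real (k choose j) * c j * (-1) ^ j)
             = (\<Sum>j=1..k-1. real (k choose (j + 1)) * c (j + 1) * (-1) ^ (j + 1))"
    by (rule sum.reindex_bij_witness[where i = "\<lambda>j. j + 1" and j = "\<lambda>j. j - 1"]) (use k in auto)
  also have "\<dots> = - (\<Sum>j=1..k-1. (-1) ^ j * real (k choose (j + 1)) *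
      (\<Sum>is | is \<in> tuples k A \<and> set (take (j + 1) is) \<subseteq> A - I. T is * prod_list (map x is)))"
    unfolding sum_negf[symmetric]
  proof (rule sum.cong[OF refl])
    fix j assume "j \<in> {1..k-1}"
    then have "j + 1 \<le> k" using k by auto
    from c_tail[OF this]
    show "real (k choose (j + 1)) * c (j + 1) * (-1) ^ (j + 1) =
      - ((-1) ^ j * real (k choose (j + 1)) *
      (\<Sum>is | is \<in> tuples k A \<and> set (take (j + 1) is) \<subseteq> A - I. T is * prod_list (map x is)))"
      by simp
  qed
  finally show ?thesis by (simp add: c0 c1[unfolded One_nat_def] algebra_simps)
qed

theorem theorem4p1:
  fixes n k :: nat and T :: "nat list \<Rightarrow> real" and x :: "nat \<Rightarrow> real" and I :: "nat set"
  assumes "n \<ge> 2" and "k \<ge> 2"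
    and "zero_diagonal k {1..n} T"
    and "nonzero_tensor k {1..n} T"
    and "symmetric_tensor k {1..n} T"
    and "even k \<or> nonnegative_tensor k {1..n} T"
    and "H_eigenpair k {1..n} T (lambda_max k {1..n} T) x"
    and "unit_vector k {1..n} x"
    and "odd k \<longrightarrow> (\<forall>i\<in>{1..n}. x i \<ge> 0)"
    and "I \<noteq> {}" and "I \<subseteq> {1..n}"
  shows "lambda_max k {1..n} T * (1 - real k * (\<Sum>i\<in>{1..n} - I. x i ^ k))
           - (\<Sum>j=1..k-1. (-1) ^ j * real (k choose (j + 1)) *
               (\<Sum>is | is \<in> tuples k {1..n} \<and> set (take (j + 1) is) \<subseteq> {1..n} - I.
                  T is * prod_list (map x is)))
           \<le> lambda_max k I T
         \<and> lambda_max k I T \<le> lambda_max k {1..n} T"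
proof
  have sub: "tuples k I \<subseteq> tuples k {1..n}" using assms(11) by (rule tuples_mono)
  have finI: "finite I" using assms(11) finite_subset by blast
  have symI: "symmetric_tensor k I T"
    using assms(5) sub by (auto simp: symmetric_tensor_def)
  have nnI: "even k \<or> nonnegative_tensor k I T"
    using assms(6) sub by (auto simp: nonnegative_tensor_def)
  have zdI: "zero_diagonal k I T" using assms(3,11) by (auto simp: zero_diagonal_def)
  have adm: "admissible k {1..n} x" using assms(9) by (simp add: admissible_def)
  have admI: "admissible k I x" using assms(9,11) by (auto simp: admissible_def)
  have one: "(\<Sum>i\<in>{1..n}. x i ^ k) = 1"
    using assms(8) admissible_abs_power[OF adm] by (simp add: unit_vector_def)
  have "(\<Sum>i\<in>I. x i ^ k) \<le> (\<Sum>i\<in>{1..n}. x i ^ k)"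
  proof (rule sum_mono2)
    show "0 \<le> x i ^ k" if "i \<in> {1..n} - I" for i
      using that by (simp flip: admissible_abs_power[OF adm])
  qed (use assms(11) in auto)
  then have le1: "(\<Sum>i\<in>I. x i ^ k) \<le> 1" using one by simp
  have "form k I T x \<le> lambda_max k I T * (\<Sum>i\<in>I. x i ^ k)"
    by (rule form_le_lambda_max[OF finI assms(10,2) symI nnI admI])
  also have "\<dots> \<le> lambda_max k I T"
    using lambda_max_nonneg[OF finI assms(10,2) symI nnI zdI] le1 by (rule mult_left_le[rotated])
  finally show "lambda_max k {1..n} T * (1 - real k * (\<Sum>i\<in>{1..n} - I. x i ^ k))
           - (\<Sum>j=1..k-1. (-1) ^ j * real (k choose (j + 1)) *
               (\<Sum>is | is \<in> tuples k {1..n} \<and> set (take (j + 1) is) \<subseteq> {1..n} - I.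
                  T is * prod_list (map x is)))
           \<le> lambda_max k I T"
    using form_restrict_eigenvector[OF _ assms(11,2,5,7) one] by simp
  show "lambda_max k I T \<le> lambda_max k {1..n} T"
    using lambda_max_principal_le[OF _ assms(11,10,2,5,6) symI nnI] by simp
qed

end
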